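(* Let $g,n\ge0$ be integers with $2g-2+n\ge1$. Then the topological space $M_{g,n}^{\rm trop}$ is connected.
   Context: Graphs. A graph $\Gamma$ with $n$ legs consists of a finite nonempty set $V(\Gamma)$ of vertices, a finite set $H(\Gamma)$ of half-edges, an involution $h\mapsto\overline h$ of $H(\Gamma)$ with exactly $n$ fixed points (the legs, which are labeled $x_1,\dots,x_n$), and an endpoint map $\epsilon:H(\Gamma)\to V(\Gamma)$. An edge is a pair $\{h,\overline h\}$ with $h\neq\overline h$; $E(\Gamma)$ is the set of edges. All graphs are connected. The valence of $v$ is $|\epsilon^{-1}(v)|$; $\Gamma$ is 3-regular if all vertices have valence 3. $b_1(\Gamma)=|E(\Gamma)|-|V(\Gamma)|+1$. Weighted graphs. A weighted graph is a pair $(\Gamma,w)$ with $w:V(\Gamma)\to\mathbb Z_{\ge 0}$; its genus is $b_1(\Gamma)+\sum_v w(v)$. $\underline 0$ is the zero weight function. For $S\subset E(\Gamma)$, the weighted contraction $(\Gamma_{/S},w_{/S})$ is obtained by contracting every edge of $S$ (with contraction map $\sigma:\Gamma\to\Gamma_{/S}$, so $E(\Gamma_{/S})=E(\Gamma)\smallsetminus S$ and the legs are unchanged) and setting $w_{/S}(\overline v)=b_1(\sigma^{-1}(\overline v))+\sum_{v\in V(\Gamma),\,\sigma(v)=\overline v}w(v)$. Moduli space. For a 3-regular graph $\Gamma$ with $b_1(\Gamma)=g$ and $n$ labeled legs, a point $p=(t_e)\in\overline{R(\Gamma,\underline 0)}:=\mathbb R_{\ge0}^{E(\Gamma)}$ (euclidean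 topology) determines the metric weighted graph $(\Gamma_{/S},\underline0_{/S},\ell_p)$ with $S=\{e:t_e=0\}$ and $\ell_p(e)=t_e$ for $e\notin S$. $M_{g,n}^{\rm trop}$ is the quotient space of $\bigsqcup_\Gamma\overline{R(\Gamma,\underline0)}$ ($\Gamma$ running over isomorphism classes of such 3-regular graphs) in which two points are identified if the corresponding metric weighted graphs are isomorphic (by a graph isomorphism preserving weights, lengths and leg labels). *)

theory Defs
  imports "HOL-Analysis.Analysis"
begin

section \<open>Graphs with labelled legs\<close>

record ('v, 'h) graph =
  verts :: "'v set"
  halfs :: "'h set"
  bar   :: "'h \<Rightarrow> 'h"
  endp  :: "'h \<Rightarrow> 'v"
  label :: "'h \<Rightarrow> nat"

definition legs :: "('v, 'h) graph \<Rightarrow> 'h set" where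
  "legs G = {h \<in> halfs G. bar G h = h}"

definition edges :: "('v, 'h) graph \<Rightarrow> 'h set set" where
  "edges G = {{h, bar G h} | h. h \<in> halfs G \<and> bar G h \<noteq> h}"

definition adjacency :: "('v, 'h) graph \<Rightarrow> 'h set \<Rightarrow> 'v rel" where
  "adjacency G K = {(endp G h, endp G (bar G h)) | h. h \<in> K}"

text \<open>The legs \<open>x\<^sub>1, \<dots>, x\<^sub>n\<close> are given by a bijection \<open>label\<close> from the set of legs onto
  \<open>{1..n}\<close>.\<close>

definition is_graph :: "nat \<Rightarrow> ('v, 'h) graph \<Rightarrow> bool" where
  "is_graph n G \<longleftrightarrow>
     finite (verts G) \<and> verts G \<noteq> {} \<and> finite (halfs G) \<and>
     (\<forall>h\<in>halfs G. bar G h \<in> halfs G \<and> bar G (bar G h) = h) \<and>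
     (\<forall>h\<in>halfs G. endp G h \<in> verts G) \<and>
     bij_betw (label G) (legs G) {1..n} \<and>
     (\<forall>u\<in>verts G. \<forall>v\<in>verts G. (u, v) \<in> (adjacency G (halfs G))\<^sup>*)"

definition valence :: "('v, 'h) graph \<Rightarrow> 'v \<Rightarrow> nat" where
  "valence G v = card {h \<in> halfs G. endp G h = v}"

definition three_regular :: "('v, 'h) graph \<Rightarrow> bool" where
  "three_regular G \<longleftrightarrow> (\<forall>v\<in>verts G. valence G v = 3)"

text \<open>The subtraction never truncates, as \<open>b1\<close> is only applied to connected graphs.\<close>

definition b1 :: "('v, 'h) graph \<Rightarrow> nat" where
  "b1 G = card (edges G) + 1 - card (verts G)"

definition graph_iso ::
    "('v \<Rightarrow> 'w) \<Rightarrow> ('h \<Rightarrow> 'k) \<Rightarrow> ('v, 'h) graph \<Rightarrow> ('w, 'k) graph \<Rightarrow> bool" where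
  "graph_iso \<phi> \<psi> G G' \<longleftrightarrow>
     bij_betw \<phi> (verts G) (verts G') \<and> bij_betw \<psi> (halfs G) (halfs G') \<and>
     (\<forall>h\<in>halfs G. \<psi> (bar G h) = bar G' (\<psi> h)) \<and>
     (\<forall>h\<in>halfs G. endp G' (\<psi> h) = \<phi> (endp G h)) \<and>
     (\<forall>h\<in>legs G. label G' (\<psi> h) = label G h)"

section \<open>Weighted contraction\<close>

definition fibre_verts :: "('v, 'h) graph \<Rightarrow> 'h set set \<Rightarrow> 'v \<Rightarrow> 'v set" where
  "fibre_verts G S v = {u \<in> verts G. (v, u) \<in> (adjacency G (\<Union>S))\<^sup>*}"

text \<open>The vertices of the contraction are the vertex sets of the connected components of the
  subgraph \<open>(V(G), S)\<close>, so the contraction map \<open>\<sigma>\<close> is \<open>fibre_verts G S\<close>.\<close>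

definition contract :: "('v, 'h) graph \<Rightarrow> 'h set set \<Rightarrow> ('v set, 'h) graph" where
  "contract G S =
     \<lparr>verts = fibre_verts G S ` verts G,
      halfs = halfs G - \<Union>S,
      bar = bar G,
      endp = (\<lambda>h. fibre_verts G S (endp G h)),
      label = label G\<rparr>"

text \<open>The subgraph \<open>\<sigma>\<^sup>-\<^sup>1(C)\<close>, without legs: its edges are the members of \<open>S\<close> contracted to \<open>C\<close>.\<close>

definition fibre :: "('v, 'h) graph \<Rightarrow> 'h set set \<Rightarrow> 'v set \<Rightarrow> ('v, 'h) graph" where
  "fibre G S C = G\<lparr>verts := C, halfs := {h \<in> \<Union>S. endp G h \<in> C}\<rparr>"

definition contract_weight ::
    "('v, 'h) graph \<Rightarrow> ('v \<Rightarrow> nat) \<Rightarrow> 'h set set \<Rightarrow> 'v set \<Rightarrow> nat" where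
  "contract_weight G w S C =
     b1 (fibre G S C) + (\<Sum>v | v \<in> verts G \<and> fibre_verts G S v = C. w v)"

section \<open>Metric weighted graphs\<close>

type_synonym ('v, 'h) mw_graph = "('v, 'h) graph \<times> ('v \<Rightarrow> nat) \<times> ('h set \<Rightarrow> real)"

definition mw_isomorphic :: "('v, 'h) mw_graph \<Rightarrow> ('w, 'k) mw_graph \<Rightarrow> bool" where
  "mw_isomorphic = (\<lambda>(G, w, l) (G', w', l').
     \<exists>\<phi> \<psi>. graph_iso \<phi> \<psi> G G' \<and>
       (\<forall>v\<in>verts G. w' (\<phi> v) = w v) \<and> (\<forall>e\<in>edges G. l' (\<psi> ` e) = l e))"

definition metric_graph_of ::
    "('v, 'h) graph \<Rightarrow> ('h set \<Rightarrow> real) \<Rightarrow> ('v set, 'h) mw_graph" where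
  "metric_graph_of G t =
     (let S = {e \<in> edges G. t e = 0} in (contract G S, contract_weight G (\<lambda>_. 0) S, t))"

definition half_edge_closed :: "('v, 'h) graph \<Rightarrow> bool" where
  "half_edge_closed G \<longleftrightarrow> (\<forall>h\<in>halfs G. bar G h \<in> halfs G \<and> endp G h \<in> verts G)"

lemma mw_isomorphic_refl: "mw_isomorphic M M"
proof -
  obtain G w l where M: "M = (G, w, l)" by (cases M)
  have "graph_iso id id G G" by (simp add: graph_iso_def)
  then show ?thesis unfolding M mw_isomorphic_def by fastforce
qed

lemma mw_isomorphic_sym:
  assumes "mw_isomorphic M M'" and "half_edge_closed (fst M)"
  shows "mw_isomorphic M' M"
proof -
  obtain G w l G' w' l' where M: "M = (G, w, l)" "M' = (G', w', l')"
    by (cases M, cases M')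
  have G: "half_edge_closed G" using assms(2) by (simp add: M)
  from assms(1) obtain \<phi> \<psi> where iso: "graph_iso \<phi> \<psi> G G'"
    and w: "\<And>v. v \<in> verts G \<Longrightarrow> w' (\<phi> v) = w v"
    and l: "\<And>e. e \<in> edges G \<Longrightarrow> l' (\<psi> ` e) = l e"
    unfolding mw_isomorphic_def M by auto
  define \<phi>' where "\<phi>' = inv_into (verts G) \<phi>"
  define \<psi>' where "\<psi>' = inv_into (halfs G) \<psi>"
  have b\<phi>: "bij_betw \<phi> (verts G) (verts G')" and b\<psi>: "bij_betw \<psi> (halfs G) (halfs G')"
    and bar: "\<And>h. h \<in> halfs G \<Longrightarrow> bar G' (\<psi> h) = \<psi> (bar G h)"
    and endp: "\<And>h. h \<in> halfs G \<Longrightarrow> endp G' (\<psi> h) = \<phi> (endp G h)"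
    and label: "\<And>h. h \<in> legs G \<Longrightarrow> label G' (\<psi> h) = label G h"
    using iso by (simp_all add: graph_iso_def)
  have cl: "bar G h \<in> halfs G" "endp G h \<in> verts G" if "h \<in> halfs G" for h
    using G that by (auto simp: half_edge_closed_def)
  have \<phi>\<phi>: "\<phi>' (\<phi> v) = v" if "v \<in> verts G" for v
    using b\<phi> that by (simp add: \<phi>'_def bij_betw_inv_into_left)
  have \<psi>\<psi>: "\<psi>' (\<psi> h) = h" if "h \<in> halfs G" for h
    using b\<psi> that by (simp add: \<psi>'_def bij_betw_inv_into_left)
  have b\<phi>': "bij_betw \<phi>' (verts G') (verts G)" and b\<psi>': "bij_betw \<psi>' (halfs G') (halfs G)"
    unfolding \<phi>'_def \<psi>'_def by (rule bij_betw_inv_into b\<phi> b\<psi>)+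
  have verts': "verts G' = \<phi> ` verts G" and halfs': "halfs G' = \<psi> ` halfs G"
    using b\<phi> b\<psi> by (simp_all add: bij_betw_def)
  have fixd: "bar G h = h" if "h \<in> halfs G" "bar G' (\<psi> h) = \<psi> h" for h
    using that \<psi>\<psi>[of h] \<psi>\<psi>[of "bar G h"] cl(1)[of h] bar[of h] by simp
  have legs': "\<exists>h\<in>legs G. k = \<psi> h" if "k \<in> legs G'" for k
    using that fixd unfolding legs_def halfs' by auto
  have edges': "\<exists>e\<in>edges G. e' = \<psi> ` e \<and> \<psi>' ` e' = e" if e': "e' \<in> edges G'" for e'
  proof -
    from e' obtain h where h: "h \<in> halfs G" "e' = {\<psi> h, bar G' (\<psi> h)}" "bar G' (\<psi> h) \<noteq> \<psi> h"
      unfolding edges_def halfs' by auto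
    have "bar G h \<noteq> h" using h bar[of h] by auto
    then have "{h, bar G h} \<in> edges G" using h(1) by (auto simp: edges_def)
    moreover have "e' = \<psi> ` {h, bar G h}" using h bar[of h] by simp
    moreover have "\<psi>' ` e' = {h, bar G h}" using h bar[of h] \<psi>\<psi> cl(1)[of h] by simp
    ultimately show ?thesis by blast
  qed
  have "graph_iso \<phi>' \<psi>' G' G"
    unfolding graph_iso_def
  proof (intro conjI ballI)
    fix k assume "k \<in> halfs G'"
    then obtain h where h: "h \<in> halfs G" "k = \<psi> h" unfolding halfs' by auto
    show "\<psi>' (bar G' k) = bar G (\<psi>' k)" using h bar \<psi>\<psi> cl by simp
    show "endp G (\<psi>' k) = \<phi>' (endp G' k)" using h endp \<psi>\<psi> \<phi>\<phi> cl by simp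
  next
    fix k assume "k \<in> legs G'"
    then obtain h where h: "h \<in> legs G" "k = \<psi> h" using legs' by blast
    then have "h \<in> halfs G" by (simp add: legs_def)
    then show "label G (\<psi>' k) = label G' k" using h label \<psi>\<psi> by simp
  qed (rule b\<phi>' b\<psi>')+
  moreover have "w (\<phi>' v) = w' v" if "v \<in> verts G'" for v
    using that w \<phi>\<phi> unfolding verts' by auto
  moreover have "l (\<psi>' ` e') = l' e'" if "e' \<in> edges G'" for e'
    using edges'[OF that] l by metis
  ultimately show ?thesis unfolding mw_isomorphic_def M prod.case by blast
qed

lemma mw_isomorphic_trans:
  assumes "mw_isomorphic M1 M2" "mw_isomorphic M2 M3" and "half_edge_closed (fst M1)"
  shows "mw_isomorphic M1 M3"
proof -
  obtain G1 w1 l1 G2 w2 l2 G3 w3 l3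
    where M: "M1 = (G1, w1, l1)" "M2 = (G2, w2, l2)" "M3 = (G3, w3, l3)"
    by (cases M1, cases M2, cases M3)
  have G1: "half_edge_closed G1" using assms(3) by (simp add: M)
  from assms(1,2) obtain \<phi> \<psi> \<phi>' \<psi>' where iso: "graph_iso \<phi> \<psi> G1 G2" "graph_iso \<phi>' \<psi>' G2 G3"
    and w: "\<And>v. v \<in> verts G1 \<Longrightarrow> w2 (\<phi> v) = w1 v" "\<And>v. v \<in> verts G2 \<Longrightarrow> w3 (\<phi>' v) = w2 v"
    and l: "\<And>e. e \<in> edges G1 \<Longrightarrow> l2 (\<psi> ` e) = l1 e" "\<And>e. e \<in> edges G2 \<Longrightarrow> l3 (\<psi>' ` e) = l2 e"
    unfolding mw_isomorphic_def M by auto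
  have b\<phi>: "bij_betw \<phi> (verts G1) (verts G2)" and b\<psi>: "bij_betw \<psi> (halfs G1) (halfs G2)"
    and bar: "\<And>h. h \<in> halfs G1 \<Longrightarrow> \<psi> (bar G1 h) = bar G2 (\<psi> h)"
    and endp: "\<And>h. h \<in> halfs G1 \<Longrightarrow> endp G2 (\<psi> h) = \<phi> (endp G1 h)"
    and label: "\<And>h. h \<in> legs G1 \<Longrightarrow> label G2 (\<psi> h) = label G1 h"
    and b\<phi>': "bij_betw \<phi>' (verts G2) (verts G3)" and b\<psi>': "bij_betw \<psi>' (halfs G2) (halfs G3)"
    and bar': "\<And>h. h \<in> halfs G2 \<Longrightarrow> \<psi>' (bar G2 h) = bar G3 (\<psi>' h)"
    and endp': "\<And>h. h \<in> halfs G2 \<Longrightarrow> endp G3 (\<psi>' h) = \<phi>' (endp G2 h)"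
    and label': "\<And>h. h \<in> legs G2 \<Longrightarrow> label G3 (\<psi>' h) = label G2 h"
    using iso by (simp_all add: graph_iso_def)
  have V: "\<phi> v \<in> verts G2" if "v \<in> verts G1" for v using b\<phi> that by (auto simp: bij_betw_def)
  have H: "\<psi> h \<in> halfs G2" if "h \<in> halfs G1" for h using b\<psi> that by (auto simp: bij_betw_def)
  have L: "h \<in> halfs G1" "\<psi> h \<in> legs G2" if "h \<in> legs G1" for h
    using that H[of h] bar[of h] by (auto simp: legs_def)
  have E: "\<psi> ` e \<in> edges G2" if e: "e \<in> edges G1" for e
  proof -
    from e obtain h where h: "h \<in> halfs G1" "e = {h, bar G1 h}" "bar G1 h \<noteq> h"
      unfolding edges_def by auto
    have "bar G1 h \<in> halfs G1" using G1 h by (auto simp: half_edge_closed_def)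
    then have "\<psi> (bar G1 h) \<noteq> \<psi> h"
      using b\<psi> h by (auto simp: bij_betw_def dest: inj_onD)
    then have "bar G2 (\<psi> h) \<noteq> \<psi> h" using bar h by simp
    moreover have "\<psi> ` e = {\<psi> h, bar G2 (\<psi> h)}" using h bar by simp
    ultimately show ?thesis using H[OF h(1)] by (auto simp: edges_def)
  qed
  have "graph_iso (\<phi>' \<circ> \<phi>) (\<psi>' \<circ> \<psi>) G1 G3"
    unfolding graph_iso_def
  proof (intro conjI ballI)
    show "bij_betw (\<phi>' \<circ> \<phi>) (verts G1) (verts G3)" by (rule bij_betw_trans[OF b\<phi> b\<phi>'])
    show "bij_betw (\<psi>' \<circ> \<psi>) (halfs G1) (halfs G3)" by (rule bij_betw_trans[OF b\<psi> b\<psi>'])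
  next
    fix h assume "h \<in> halfs G1"
    then show "(\<psi>' \<circ> \<psi>) (bar G1 h) = bar G3 ((\<psi>' \<circ> \<psi>) h)"
      and "endp G3 ((\<psi>' \<circ> \<psi>) h) = (\<phi>' \<circ> \<phi>) (endp G1 h)"
      using H bar bar' endp endp' by simp_all
  next
    fix h assume "h \<in> legs G1"
    then show "label G3 ((\<psi>' \<circ> \<psi>) h) = label G1 h" using L label label' by simp
  qed
  moreover have "w3 ((\<phi>' \<circ> \<phi>) v) = w1 v" if "v \<in> verts G1" for v using that V w by simp
  moreover have "l3 ((\<psi>' \<circ> \<psi>) ` e) = l1 e" if "e \<in> edges G1" for e
    using that E l by (simp only: image_comp[symmetric])
  ultimately show ?thesis unfolding mw_isomorphic_def M prod.case by blast
qed

section \<open>Quotient spaces\<close>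

definition quotient_topology :: "'a topology \<Rightarrow> 'a rel \<Rightarrow> 'a set topology" where
  "quotient_topology X r = topology (\<lambda>U. U \<subseteq> topspace X // r \<and> openin X (\<Union>U))"

lemma openin_quotient_topology:
  assumes r: "equiv (topspace X) r"
  shows "openin (quotient_topology X r) U \<longleftrightarrow> U \<subseteq> topspace X // r \<and> openin X (\<Union>U)"
proof -
  have inter: "\<Union>(A \<inter> B) = \<Union>A \<inter> \<Union>B" if "A \<subseteq> topspace X // r" "B \<subseteq> topspace X // r" for A B
  proof
    show "\<Union>A \<inter> \<Union>B \<subseteq> \<Union>(A \<inter> B)"
    proof
      fix x assume "x \<in> \<Union>A \<inter> \<Union>B"
      then obtain C D where CD: "C \<in> A" "D \<in> B" "x \<in> C" "x \<in> D" by blast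
      then have "C \<in> topspace X // r" "D \<in> topspace X // r" using that by auto
      then have "C = D" using quotient_disj[OF r, of C D] CD by blast
      with CD show "x \<in> \<Union>(A \<inter> B)" by blast
    qed
  qed auto
  have union: "\<Union>(\<Union>\<K>) = (\<Union>A\<in>\<K>. \<Union>A)" for \<K> :: "'a set set set" by blast
  have "istopology (\<lambda>U. U \<subseteq> topspace X // r \<and> openin X (\<Union>U))"
    unfolding istopology_def
  proof (intro conjI allI impI)
    fix A B
    assume A: "A \<subseteq> topspace X // r \<and> openin X (\<Union>A)"
      and B: "B \<subseteq> topspace X // r \<and> openin X (\<Union>B)"
    then show "A \<inter> B \<subseteq> topspace X // r" by blast
    from A B have "\<Union>(A \<inter> B) = \<Union>A \<inter> \<Union>B" by (intro inter) simp_all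
    then show "openin X (\<Union>(A \<inter> B))" using A B by (simp only: openin_Int)
  next
    fix \<K>
    assume K: "\<forall>A\<in>\<K>. A \<subseteq> topspace X // r \<and> openin X (\<Union>A)"
    then show "\<Union>\<K> \<subseteq> topspace X // r" by blast
    show "openin X (\<Union>(\<Union>\<K>))"
      unfolding union by (rule openin_Union) (use K in blast)
  qed
  then show ?thesis
    by (simp add: quotient_topology_def)
qed

lemma topspace_quotient_topology:
  assumes r: "equiv (topspace X) r"
  shows "topspace (quotient_topology X r) = topspace X // r"
proof -
  have "openin (quotient_topology X r) (topspace X // r)"
    by (simp add: openin_quotient_topology[OF r] Union_quotient[OF r])
  then show ?thesis
    using openin_quotient_topology[OF r, of "topspace (quotient_topology X r)"]
    by (intro subset_antisym openin_subset) simp_all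
qed

lemma quotient_map_quotient_topology:
  assumes r: "equiv (topspace X) r"
  shows "quotient_map X (quotient_topology X r) (\<lambda>x. r `` {x})"
  unfolding quotient_map_def
proof (intro conjI allI impI)
  show "(\<lambda>x. r `` {x}) ` topspace X = topspace (quotient_topology X r)"
    by (auto simp: topspace_quotient_topology[OF r] quotient_def)
next
  fix U assume "U \<subseteq> topspace (quotient_topology X r)"
  then have U: "U \<subseteq> topspace X // r" by (simp add: topspace_quotient_topology[OF r])
  have "{x \<in> topspace X. r `` {x} \<in> U} = \<Union>U"
  proof (intro equalityI subsetI)
    fix x assume "x \<in> {x \<in> topspace X. r `` {x} \<in> U}"
    then show "x \<in> \<Union>U" using equiv_class_self[OF r] by blast
  next
    fix x assume "x \<in> \<Union>U"
    then obtain C where C: "C \<in> U" "x \<in> C" by blast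
    then obtain y where y: "y \<in> topspace X" "C = r `` {y}" using U by (auto simp: quotient_def)
    then have "(y, x) \<in> r" using C by blast
    then show "x \<in> {x \<in> topspace X. r `` {x} \<in> U}"
      using C y equiv_class_eq[OF r, of y x] equiv_class_eq_iff[OF r, of y x] by simp
  qed
  then show "openin X {x \<in> topspace X. r `` {x} \<in> U} \<longleftrightarrow> openin (quotient_topology X r) U"
    using U by (simp add: openin_quotient_topology[OF r])
qed

section \<open>The moduli space of tropical curves\<close>

text \<open>Every finite graph is isomorphic to one whose vertices and half-edges are natural numbers,
  so isomorphism classes may be taken among these.\<close>

type_synonym ngraph = "(nat, nat) graph"

definition regular_graphs :: "nat \<Rightarrow> nat \<Rightarrow> ngraph set" where
  "regular_graphs g n = {G. is_graph n G \<and> three_regular G \<and> b1 G = g}"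

definition graph_iso_rel :: "ngraph rel" where
  "graph_iso_rel = {(G, G'). \<exists>\<phi> \<psi>. graph_iso \<phi> \<psi> G G'}"

text \<open>One chosen graph in each isomorphism class.\<close>

definition regular_graph_reps :: "nat \<Rightarrow> nat \<Rightarrow> ngraph set" where
  "regular_graph_reps g n =
     (\<lambda>G. SOME G'. G' \<in> regular_graphs g n \<and> (G, G') \<in> graph_iso_rel) ` regular_graphs g n"

text \<open>Functions in the product topology are \<open>undefined\<close> off the edge set, so a point of the
  closed cone is exactly a vector indexed by the edges.\<close>

definition closed_cone :: "('v, 'h) graph \<Rightarrow> ('h set \<Rightarrow> real) topology" where
  "closed_cone G = product_topology (\<lambda>_. top_of_set {0..}) (edges G)"

definition cones :: "nat \<Rightarrow> nat \<Rightarrow> (ngraph \<times> (nat set \<Rightarrow> real)) topology" where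
  "cones g n = sum_topology closed_cone (regular_graph_reps g n)"

definition cones_rel :: "nat \<Rightarrow> nat \<Rightarrow> (ngraph \<times> (nat set \<Rightarrow> real)) rel" where
  "cones_rel g n = {((G, t), (G', t')).
     (G, t) \<in> topspace (cones g n) \<and> (G', t') \<in> topspace (cones g n) \<and>
     mw_isomorphic (metric_graph_of G t) (metric_graph_of G' t')}"

lemma regular_graph_reps_subset: "regular_graph_reps g n \<subseteq> regular_graphs g n"
proof
  fix R assume "R \<in> regular_graph_reps g n"
  then obtain G where G: "G \<in> regular_graphs g n"
    "R = (SOME G'. G' \<in> regular_graphs g n \<and> (G, G') \<in> graph_iso_rel)"
    unfolding regular_graph_reps_def by blast
  have "graph_iso id id G G" by (simp add: graph_iso_def)
  then have "G \<in> regular_graphs g n \<and> (G, G) \<in> graph_iso_rel"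
    using G(1) unfolding graph_iso_rel_def by blast
  then show "R \<in> regular_graphs g n"
    unfolding G(2) by (rule someI2) simp
qed

lemma half_edge_closed_metric_graph_of:
  assumes "is_graph n G"
  shows "half_edge_closed (fst (metric_graph_of G t))"
proof -
  define S where "S = {e \<in> edges G. t e = 0}"
  have G: "bar G h \<in> halfs G" "bar G (bar G h) = h" "endp G h \<in> verts G" if "h \<in> halfs G" for h
    using assms that by (auto simp: is_graph_def)
  have "bar G h \<notin> \<Union>S" if h: "h \<in> halfs G" "h \<notin> \<Union>S" for h
  proof
    assume "bar G h \<in> \<Union>S"
    then obtain k where k: "k \<in> halfs G" "{k, bar G k} \<in> S" "bar G h = k \<or> bar G h = bar G k"
      unfolding S_def edges_def by auto
    from k(3) have "h = bar G k \<or> h = k" using G(2)[OF h(1)] G(2)[OF k(1)] by metis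
    then show False using h(2) k(2) by blast
  qed
  then have "half_edge_closed (contract G S)"
    using G by (simp add: half_edge_closed_def contract_def)
  then show ?thesis by (simp add: metric_graph_of_def S_def Let_def)
qed

lemma equiv_cones_rel: "equiv (topspace (cones g n)) (cones_rel g n)"
proof -
  have cl: "half_edge_closed (fst (metric_graph_of G t))" if "(G, t) \<in> topspace (cones g n)" for G t
  proof -
    have "G \<in> regular_graph_reps g n" using that by (auto simp: cones_def)
    then have "is_graph n G" using regular_graph_reps_subset by (auto simp: regular_graphs_def)
    then show ?thesis by (rule half_edge_closed_metric_graph_of)
  qed
  show ?thesis
  proof (rule equivI)
    show "cones_rel g n \<subseteq> topspace (cones g n) \<times> topspace (cones g n)"
      by (auto simp: cones_rel_def)
    show "refl_on (topspace (cones g n)) (cones_rel g n)"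
      by (auto simp: refl_on_def cones_rel_def mw_isomorphic_refl)
    show "sym (cones_rel g n)"
    proof (rule symI)
      fix p q assume "(p, q) \<in> cones_rel g n"
      then show "(q, p) \<in> cones_rel g n"
        unfolding cones_rel_def by (auto intro: mw_isomorphic_sym cl)
    qed
    show "trans (cones_rel g n)"
    proof (rule transI)
      fix p q r assume "(p, q) \<in> cones_rel g n" "(q, r) \<in> cones_rel g n"
      then show "(p, r) \<in> cones_rel g n"
        unfolding cones_rel_def by (auto intro: mw_isomorphic_trans cl)
    qed
  qed
qed

definition M_trop :: "nat \<Rightarrow> nat \<Rightarrow> (ngraph \<times> (nat set \<Rightarrow> real)) set topology" where
  "M_trop g n = quotient_topology (cones g n) (cones_rel g n)"

end

(* Every closed cone is connected and contains the origin. At the origin all edges are contracted,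
   which leaves a single vertex of weight g carrying the n labelled legs, whichever graph one started
   from. So the images of the cones are connected sets that share a point. *)

theory Submission
  imports Defs
begin

lemma Union_edges:
  assumes "is_graph n G"
  shows "\<Union>(edges G) = halfs G - legs G"
proof -
  have inv: "bar G h \<in> halfs G" "bar G (bar G h) = h" if "h \<in> halfs G" for h
    using assms that by (auto simp: is_graph_def)
  show ?thesis
  proof (intro equalityI subsetI)
    fix h assume "h \<in> \<Union>(edges G)"
    then obtain k where k: "k \<in> halfs G" "bar G k \<noteq> k" "h = k \<or> h = bar G k"
      by (auto simp: edges_def)
    then show "h \<in> halfs G - legs G"
      using inv[OF k(1)] by (auto simp: legs_def)
  next
    fix h assume "h \<in> halfs G - legs G"
    then show "h \<in> \<Union>(edges G)" by (auto simp: edges_def legs_def)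
  qed
qed

text \<open>Connectedness of \<open>G\<close> enters here: edges alone already join all vertices, so
  contracting all of them merges everything into one fibre.\<close>

lemma fibre_verts_edges:
  assumes G: "is_graph n G" and v: "v \<in> verts G"
  shows "fibre_verts G (edges G) v = verts G"
proof -
  \<comment> \<open>Legs only contribute loops to the adjacency relation.\<close>
  have "adjacency G (halfs G) \<subseteq> (adjacency G (\<Union>(edges G)))\<^sup>*"
    unfolding Union_edges[OF G] unfolding adjacency_def legs_def
    by clarify (metis (mono_tags, lifting) DiffI mem_Collect_eq r_into_rtrancl rtrancl.rtrancl_refl)
  then have "(adjacency G (halfs G))\<^sup>* \<subseteq> (adjacency G (\<Union>(edges G)))\<^sup>*"
    by (rule rtrancl_subset_rtrancl)
  then show ?thesis
    using G v unfolding fibre_verts_def is_graph_def by blast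
qed

lemma contract_edges:
  assumes G: "is_graph n G"
  shows "verts (contract G (edges G)) = {verts G}"
    and "halfs (contract G (edges G)) = legs G"
    and "legs (contract G (edges G)) = legs G"
    and "edges (contract G (edges G)) = {}"
proof -
  have "verts G \<noteq> {}" using G by (simp add: is_graph_def)
  then show "verts (contract G (edges G)) = {verts G}"
    using fibre_verts_edges[OF G] by (auto simp: contract_def)
  show H: "halfs (contract G (edges G)) = legs G"
    unfolding contract_def Union_edges[OF G] by (auto simp: legs_def)
  have B: "bar (contract G (edges G)) = bar G" by (simp add: contract_def)
  show "legs (contract G (edges G)) = legs G"
    unfolding legs_def[of "contract G (edges G)"] H B by (auto simp: legs_def)
  show "edges (contract G (edges G)) = {}"
    unfolding edges_def[of "contract G (edges G)"] H B by (auto simp: legs_def)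
qed

text \<open>The fibre over the only vertex is \<open>G\<close> with its legs deleted. As
  \<open>b1\<close> counts just edges and vertices, deleting legs does not change it, and the
  original weights contribute 0.\<close>

lemma contract_weight_edges:
  assumes G: "is_graph n G"
  shows "contract_weight G (\<lambda>_. 0) (edges G) (verts G) = b1 G"
proof -
  have H: "halfs (fibre G (edges G) (verts G)) = halfs G - legs G"
    using G unfolding fibre_def Union_edges[OF G] by (auto simp: is_graph_def)
  have "edges (fibre G (edges G) (verts G)) = edges G"
    unfolding edges_def[of "fibre G (edges G) (verts G)"] H
    by (auto simp: fibre_def legs_def edges_def[of G])
  then show ?thesis
    \<comment> \<open>\<open>fibre\<close> stays folded in the first call so that the equation for
      its edges can rewrite; the second call reads off its vertex set.\<close>
    by (simp add: contract_weight_def b1_def) (simp add: fibre_def)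
qed

text \<open>What survives is one vertex of weight \<open>b1\<close> and the labelled legs. No edge
  is left to measure, so \<open>l\<close> and \<open>l'\<close> may be arbitrary.\<close>

lemma mw_isomorphic_contract_edges:
  assumes G: "is_graph n G" and G': "is_graph n G'" and b: "b1 G = b1 G'"
  shows "mw_isomorphic (contract G (edges G), contract_weight G (\<lambda>_. 0) (edges G), l)
    (contract G' (edges G'), contract_weight G' (\<lambda>_. 0) (edges G'), l')"
proof -
  have lab: "bij_betw (label G) (legs G) {1..n}" and lab': "bij_betw (label G') (legs G') {1..n}"
    using G G' by (simp_all add: is_graph_def)
  \<comment> \<open>A leg of \<open>G\<close> goes to the leg of \<open>G'\<close> with the same
    label.\<close>
  define \<psi> where "\<psi> = inv_into (legs G') (label G') \<circ> label G"
  have \<psi>: "bij_betw \<psi> (legs G) (legs G')"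
    unfolding \<psi>_def by (rule bij_betw_trans[OF lab bij_betw_inv_into[OF lab']])
  have leg: "\<psi> h \<in> legs G'" if "h \<in> legs G" for h
    using \<psi> that by (auto simp: bij_betw_def)
  have label: "label G' (\<psi> h) = label G h" if "h \<in> legs G" for h
    using bij_betw_inv_into_right[OF lab', of "label G h"] bij_betw_apply[OF lab that]
    by (simp add: \<psi>_def)
  \<comment> \<open>Vertices of a contraction are sets of old vertices; the single one on the right
    is \<open>verts G'\<close> itself, hence the constant vertex map.\<close>
  have "graph_iso (\<lambda>_. verts G') \<psi> (contract G (edges G)) (contract G' (edges G'))"
    unfolding graph_iso_def contract_edges[OF G] contract_edges[OF G']
  proof (intro conjI ballI)
    fix h assume h: "h \<in> legs G"
    then show "\<psi> (bar (contract G (edges G)) h) = bar (contract G' (edges G')) (\<psi> h)"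
      using leg[OF h] by (simp add: contract_def legs_def)
    have "endp G' (\<psi> h) \<in> verts G'"
      using leg[OF h] G' by (simp add: is_graph_def legs_def)
    then show "endp (contract G' (edges G')) (\<psi> h) = verts G'"
      using fibre_verts_edges[OF G'] by (simp add: contract_def)
    show "label (contract G' (edges G')) (\<psi> h) = label (contract G (edges G)) h"
      using label[OF h] by (simp add: contract_def)
  qed (use \<psi> in \<open>simp_all add: bij_betw_def\<close>)
  then show ?thesis
    unfolding mw_isomorphic_def prod.case
    using contract_weight_edges[OF G] contract_weight_edges[OF G'] b
      contract_edges[OF G] by auto
qed

lemma connected_space_closed_cone: "connected_space (closed_cone G)"
  unfolding closed_cone_def connected_space_product_topology
  by (simp add: connected_space_subtopology convex_connected)

text \<open>The restricted lambda makes the function \<open>undefined\<close> off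
  \<open>edges G\<close>, as points of the product topology must be.\<close>

definition cone_origin :: "('v, 'h) graph \<Rightarrow> 'h set \<Rightarrow> real" where
  "cone_origin G = (\<lambda>e\<in>edges G. 0)"

lemma cone_origin_in_topspace: "cone_origin G \<in> topspace (closed_cone G)"
  by (simp add: cone_origin_def closed_cone_def)

lemma metric_graph_of_cone_origin:
  "metric_graph_of G (cone_origin G) =
    (contract G (edges G), contract_weight G (\<lambda>_. 0) (edges G), cone_origin G)"
proof -
  have "{e \<in> edges G. cone_origin G e = 0} = edges G" by (auto simp: cone_origin_def)
  then show ?thesis by (simp add: metric_graph_of_def Let_def)
qed

lemma cone_origins_related:
  assumes "G \<in> regular_graph_reps g n" and "G' \<in> regular_graph_reps g n"
  shows "((G, cone_origin G), (G', cone_origin G')) \<in> cones_rel g n"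
proof -
  have "is_graph n G" "is_graph n G'" "b1 G = b1 G'"
    using assms regular_graph_reps_subset[of g n] by (auto simp: regular_graphs_def)
  then show ?thesis
    using assms
    by (auto simp: cones_rel_def cones_def cone_origin_in_topspace metric_graph_of_cone_origin
        intro: mw_isomorphic_contract_edges)
qed

theorem mainTheorem5:
  fixes g n :: nat
  assumes "2 * int g - 2 + int n \<ge> 1"
  shows "connected_space (M_trop g n)"
proof -
  let ?q = "\<lambda>x. cones_rel g n `` {x}"
  let ?cone = "\<lambda>G. (\<lambda>t. ?q (G, t)) ` topspace (closed_cone G)"
  have q: "quotient_map (cones g n) (M_trop g n) ?q"
    unfolding M_trop_def by (rule quotient_map_quotient_topology[OF equiv_cones_rel])
  \<comment> \<open>Each \<open>?cone G\<close> is the continuous image of a connected cone, first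
    injected into the disjoint sum and then projected to the quotient.\<close>
  have conn: "connectedin (M_trop g n) (?cone G)" if G: "G \<in> regular_graph_reps g n" for G
  proof -
    have "continuous_map (closed_cone G) (M_trop g n) (?q \<circ> (\<lambda>t. (G, t)))"
      using continuous_map_component_injection[OF G] quotient_imp_continuous_map[OF q]
      unfolding cones_def by (rule continuous_map_compose)
    then have "connectedin (M_trop g n) ((?q \<circ> (\<lambda>t. (G, t))) ` topspace (closed_cone G))"
      by (rule connectedin_continuous_map_image)
        (simp add: connectedin_topspace connected_space_closed_cone)
    then show ?thesis by (simp add: comp_def)
  qed
  \<comment> \<open>The origins of any two cones are related, so they define the same class, which
    therefore lies in the image of every cone.\<close>
  have common: "?q (G', cone_origin G') \<in> ?cone G"
    if "G \<in> regular_graph_reps g n" "G' \<in> regular_graph_reps g n" for G G'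
    using equiv_class_eq[OF equiv_cones_rel cone_origins_related[OF that(2,1)]]
      cone_origin_in_topspace by (rule image_eqI)
  have "topspace (M_trop g n) = ?q ` topspace (cones g n)"
    using quotient_imp_surjective_map[OF q] by simp
  also have "\<dots> = \<Union>(?cone ` regular_graph_reps g n)"
    by (fastforce simp: cones_def)
  finally have top: "topspace (M_trop g n) = \<Union>(?cone ` regular_graph_reps g n)" .
  have "connectedin (M_trop g n) (\<Union>(?cone ` regular_graph_reps g n))"
  \<comment> \<open>Without representatives the union is empty, which counts as connected; otherwise
    the origin of any chosen one supplies the common point.\<close>
  proof (cases "regular_graph_reps g n = {}")
    case False
    then obtain G' where "G' \<in> regular_graph_reps g n" by blast
    then have "\<Inter>(?cone ` regular_graph_reps g n) \<noteq> {}" using common by blast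
    then show ?thesis using conn by (intro connectedin_Union) auto
  qed simp
  then show ?thesis unfolding top[symmetric] connectedin_topspace .
qed

end
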